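(* Let $q>1$, $\mathcal{Q}=\{q^n:n\in\mathbb{N}_0\}$, $a\in\mathcal{Q}$, $r\in\mathbb{N}$, and let $f_0,f_1,\ldots,f_r:[a,+\infty[\rightarrow\mathbb{R}$. If $$\lim_{T\to+\infty}\inf_{T'\ge T}\int_a^{T'}\left(\sum_{i=0}^{r}f_i(t)\,D_q^i[\eta\circ\sigma^{r-i}](t)\right)d_qt=0$$ for all $\eta:[a,+\infty[\rightarrow\mathbb{R}$ such that $\eta(a)=0$, $D_q[\eta](a)=0$, ..., $D_q^{r-1}[\eta](a)=0$, then $$\sum_{i=0}^{r}(-1)^i\left(\frac1q\right)^{\frac{i(i-1)}{2}}D_q^i[f_i](t)=0\quad\text{for all }t\in[a,+\infty[.$$
   Context: Here $q>1$ is a fixed real, $\mathcal{Q}=\{q^n:n\in\mathbb{N}_0\}$, $\mathbb{N}=\{1,2,\ldots\}$, and intervals are $q$-intervals: $[a,+\infty[=\{t\in\mathcal{Q}:t\ge a\}$. The map $\sigma$ is $\sigma(t)=qt$, with $\sigma^0=\mathrm{id}$ and $\sigma^k(t)=q^kt$. The Jackson $q$-difference operator is $D_q[f](t)=\frac{f(qt)-f(t)}{(q-1)t}$, with $D_q^0[f]=f$ and $D_q^i[f]=D_q[D_q^{i-1}[f]]$. For $b=aq^n$ ($n\in\mathbb{N}_0$), $\int_a^bf(t)\,d_qt=a(q-1)\sum_{k=0}^{n-1}q^kf(aq^k)$. In $\lim_{T\to+\infty}\inf_{T'\ge T}$, $T$ and $T'$ range over elements of $\mathcal{Q}$ with $T'\ge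 T>a$, and infima and limits are taken in $\overline{\mathbb{R}}=\mathbb{R}\cup\{\pm\infty\}$. *)

theory Defs
  imports Complex_Main "HOL-Library.Extended_Real"
begin

text \<open>
  Functions on \<open>q\<close>-intervals are represented by total functions \<open>real \<Rightarrow> real\<close>. The operators
  below only inspect their argument at points \<open>q ^ k * t\<close> with \<open>k :: nat\<close>, where \<open>t\<close> is the point of
  evaluation (or the lower bound of the integral), so values outside \<open>qatLeast q a\<close> are never used.
\<close>

definition qset :: "real \<Rightarrow> real set" where
  "qset q = {q ^ n | n :: nat. True}"

definition qatLeast :: "real \<Rightarrow> real \<Rightarrow> real set" where
  "qatLeast q a = {t \<in> qset q. a \<le> t}"

definition qsigma :: "real \<Rightarrow> real \<Rightarrow> real" where
  "qsigma q t = q * t"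

definition qdiff :: "real \<Rightarrow> (real \<Rightarrow> real) \<Rightarrow> real \<Rightarrow> real" where
  "qdiff q f t = (f (q * t) - f t) / ((q - 1) * t)"

text \<open>
  Meaningful only for \<open>b = a * q ^ n\<close>; then the exponent \<open>n\<close> is unique if \<open>q > 1\<close> and \<open>a > 0\<close>.
\<close>

definition qintegral :: "real \<Rightarrow> real \<Rightarrow> real \<Rightarrow> (real \<Rightarrow> real) \<Rightarrow> real" where
  "qintegral q a b f =
     (let n = (THE n :: nat. b = a * q ^ n)
      in a * (q - 1) * (\<Sum>k<n. q ^ k * f (a * q ^ k)))"

text \<open>The filter of \<open>T \<rightarrow> +\<infinity>\<close> along the points \<open>T > a\<close> of \<open>qset q\<close>.\<close>

definition qat_top :: "real \<Rightarrow> real \<Rightarrow> real filter" where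
  "qat_top q a = inf at_top (principal {T \<in> qset q. a < T})"

end

theory Submission imports Defs begin

text \<open>
  The statement is a fundamental lemma of the calculus of variations, and it is proved by testing
  with functions \<open>\<eta>\<close> that vanish on the lattice \<open>a, a q, a q\<^sup>2, \<dots>\<close> except at one point.

  The adjoint of the \<open>q\<close>-difference operator is \<open>u \<mapsto> - D\<^sub>q[u]\<close> with a shift of the other factor
  (\<open>qintegral_by_parts\<close>), and that shift can be pulled into the argument of a higher difference at
  the cost of a power of \<open>1/q\<close>, because \<open>D\<^sub>q[v \<circ> \<sigma>] = q D\<^sub>q[v] \<circ> \<sigma>\<close> (\<open>qdiff_funpow_shift\<close>). Moving
  all \<open>i\<close> differences off \<open>\<eta> \<circ> \<sigma>\<^bsup>r-i\<^esup>\<close> therefore produces the sign \<open>(-1)\<^sup>i\<close>, the factor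
  \<open>(1/q)\<^bsup>0+1+\<dots>+(i-1)\<^esup>\<close> and the function \<open>\<eta> \<circ> \<sigma>\<^sup>r\<close>, the same for all \<open>i\<close>
  (\<open>qintegral_by_parts_iterated\<close>). If \<open>\<eta>\<close> vanishes at the \<open>r\<close> lattice points starting at \<open>a\<close> and at
  the \<open>r\<close> lattice points starting at \<open>T'\<close>, no boundary terms arise, and the integral equals that of
  \<open>E(t) \<eta>(q\<^sup>r t)\<close>, where \<open>E\<close> is the Euler--Lagrange expression of the conclusion.

  When \<open>\<eta>\<close> is the indicator function of the lattice point \<open>a q\<^bsup>m+r\<^esup>\<close>, it is admissible, and for all
  large \<open>T'\<close> the integral is the constant \<open>a (q - 1) q\<^sup>m E(a q\<^sup>m)\<close>. The lower limit is this constant,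
  so that \<open>E(a q\<^sup>m) = 0\<close>.
\<close>

lemma qsigma_funpow: "(qsigma q ^^ n) t = q ^ n * t"
  by (induction n) (simp_all add: qsigma_def)

lemma qintegral_eq_sum:
  assumes "q > 1" "a \<noteq> 0"
  shows "qintegral q a (a * q ^ n) g = a * (q - 1) * (\<Sum>k<n. q ^ k * g (a * q ^ k))"
proof -
  have "(THE k. a * q ^ n = a * q ^ k) = n"
    using assms by (intro the_equality) auto
  then show ?thesis by (simp add: qintegral_def)
qed

lemma qintegral_sum:
  "qintegral q a b (\<lambda>t. \<Sum>i\<in>I. g i t) = (\<Sum>i\<in>I. qintegral q a b (g i))"
  by (simp add: qintegral_def Let_def sum_distrib_left sum.swap[of _ I])

lemma qintegral_cmult: "qintegral q a b (\<lambda>t. c * g t) = c * qintegral q a b g"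
  by (simp add: qintegral_def Let_def sum_distrib_left ac_simps)

text \<open>
  On the lattice this is Abel summation: the weight \<open>(q - 1) t\<close> of the integral at \<open>t\<close> cancels the
  denominator of the difference quotient.
\<close>

lemma qintegral_by_parts:
  assumes "q > 1" "a \<noteq> 0"
  shows "qintegral q a (a * q ^ n) (\<lambda>t. u t * qdiff q v t) =
    u (a * q ^ n) * v (a * q ^ n) - u a * v a
      - qintegral q a (a * q ^ n) (\<lambda>t. qdiff q u t * v (q * t))"
proof -
  have weight: "a * (q - 1) * (q ^ k * (x * qdiff q w (a * q ^ k))) =
      x * (w (a * q ^ Suc k) - w (a * q ^ k))" for k x w
    using assms by (simp add: qdiff_def field_simps)
  have weight': "a * (q - 1) * (q ^ k * (qdiff q w (a * q ^ k) * x)) =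
      x * (w (a * q ^ Suc k) - w (a * q ^ k))" for k x w
    using weight[of k x w] by (simp add: mult.commute)
  have "(\<Sum>k<n. u (a * q ^ k) * (v (a * q ^ Suc k) - v (a * q ^ k))) =
      u (a * q ^ n) * v (a * q ^ n) - u a * v a
        - (\<Sum>k<n. v (a * q ^ Suc k) * (u (a * q ^ Suc k) - u (a * q ^ k)))"
    by (induction n) (simp_all add: algebra_simps)
  then show ?thesis
    unfolding qintegral_eq_sum[OF assms] sum_distrib_left weight weight'
    by (simp add: mult.left_commute)
qed

lemma qdiff_cmult: "qdiff q (\<lambda>t. c * v t) = (\<lambda>t. c * qdiff q v t)"
  by (simp add: qdiff_def fun_eq_iff right_diff_distrib)

lemma qdiff_funpow_shift:
  assumes "q \<noteq> 0"
  shows "(qdiff q ^^ j) (\<lambda>t. v (q * t)) = (\<lambda>t. q ^ j * (qdiff q ^^ j) v (q * t))"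
proof (induction j)
  case (Suc j)
  have "qdiff q (\<lambda>t. w (q * t)) = (\<lambda>t. q * qdiff q w (q * t))" for w
    using assms by (simp add: qdiff_def fun_eq_iff mult.left_commute[of "q - 1" q])
  then show ?case
    using Suc by (simp add: qdiff_cmult mult.assoc mult.left_commute)
qed simp

lemma qdiff_funpow_eq_0:
  assumes "\<And>k. k \<le> j \<Longrightarrow> v (q ^ k * t) = 0"
  shows "(qdiff q ^^ j) v t = 0"
  using assms
proof (induction j arbitrary: t)
  case 0
  then show ?case using "0.prems"[of 0] by simp
next
  case (Suc j)
  have "(qdiff q ^^ j) v t = 0"
    by (rule Suc.IH) (simp add: Suc.prems)
  moreover have "(qdiff q ^^ j) v (q * t) = 0"
  proof (rule Suc.IH)
    fix k assume "k \<le> j"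
    then show "v (q ^ k * (q * t)) = 0"
      using Suc.prems[of "Suc k"] by (simp add: ac_simps)
  qed
  ultimately show ?case by (simp add: qdiff_def[of q "(qdiff q ^^ j) v"])
qed

text \<open>
  Each integration by parts lowers the order of the difference of \<open>\<eta>\<close> from \<open>Suc i\<close> to \<open>i\<close> and
  composes it with \<open>\<sigma>\<close>; commuting \<open>\<sigma>\<close> past the remaining \<open>i\<close> differences costs \<open>(1/q)\<^sup>i\<close>, so the
  exponents add up to a triangular number. The differences of \<open>\<eta>\<close> in the boundary terms only see
  the \<open>m + i\<close> lattice points from an endpoint on.
\<close>

lemma qintegral_by_parts_iterated:
  assumes q: "q > 1" and a: "a \<noteq> 0"
    and at_a: "\<And>k. k < m + i \<Longrightarrow> \<eta> (q ^ k * a) = 0"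
    and at_b: "\<And>k. k < m + i \<Longrightarrow> \<eta> (q ^ k * (a * q ^ n)) = 0"
  shows "qintegral q a (a * q ^ n) (\<lambda>t. u t * (qdiff q ^^ i) (\<lambda>s. \<eta> (q ^ m * s)) t) =
    (-1) ^ i * (1 / q) ^ (i * (i - 1) div 2) *
      qintegral q a (a * q ^ n) (\<lambda>t. (qdiff q ^^ i) u t * \<eta> (q ^ (m + i) * t))"
  using at_a at_b
proof (induction i arbitrary: u m)
  case 0
  then show ?case by simp
next
  case (Suc i)
  let ?I = "qintegral q a (a * q ^ n)"
  let ?D = "\<lambda>j m. (qdiff q ^^ j) (\<lambda>s. \<eta> (q ^ m * s))"
  have boundary: "?D i m t = 0" if "\<And>k. k < m + Suc i \<Longrightarrow> \<eta> (q ^ k * t) = 0" for t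
  proof (rule qdiff_funpow_eq_0)
    fix k assume "k \<le> i"
    then show "\<eta> (q ^ m * (q ^ k * t)) = 0"
      using that[of "m + k"] by (simp add: power_add ac_simps)
  qed
  have bd: "?D i m a = 0" "?D i m (a * q ^ n) = 0"
    using Suc.prems by (auto intro!: boundary)
  have "(\<lambda>t. q ^ i * ?D i m (q * t)) = ?D i (Suc m)"
    using qdiff_funpow_shift[of q i "\<lambda>s. \<eta> (q ^ m * s)"] q by (simp add: ac_simps)
  then have shift: "?D i m (q * t) = (1 / q) ^ i * ?D i (Suc m) t" for t
    using q by (auto simp: fun_eq_iff field_simps dest: spec[of _ t])
  have exponent: "Suc i * (Suc i - 1) div 2 = i + i * (i - 1) div 2"
  proof -
    have "Suc i * (Suc i - 1) = i * 2 + i * (i - 1)" by (cases i) simp_all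
    then show ?thesis by simp
  qed
  have "?I (\<lambda>t. u t * ?D (Suc i) m t) = - ?I (\<lambda>t. qdiff q u t * ?D i m (q * t))"
    using qintegral_by_parts[OF q a, of n u "?D i m"] bd by simp
  also have "\<dots> = - ((1 / q) ^ i * ?I (\<lambda>t. qdiff q u t * ?D i (Suc m) t))"
    unfolding shift qintegral_cmult[symmetric] by (simp only: mult.left_commute)
  also have "?I (\<lambda>t. qdiff q u t * ?D i (Suc m) t) =
      (-1) ^ i * (1 / q) ^ (i * (i - 1) div 2) *
        ?I (\<lambda>t. (qdiff q ^^ i) (qdiff q u) t * \<eta> (q ^ (Suc m + i) * t))"
    using Suc.prems by (intro Suc.IH) auto
  finally show ?case
    unfolding exponent power_add[of "1 / q" i]
    by (simp only: funpow_Suc_right comp_apply power_Suc add_Suc add_Suc_right) simp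
qed

text \<open>
  The compositions with \<open>\<sigma>\<^bsup>r-i\<^esup>\<close> are what makes the terms combine: \<open>i\<close> integrations by parts add
  \<open>i\<close> further shifts, so every term ends up with the same factor \<open>\<eta> \<circ> \<sigma>\<^sup>r\<close>.
\<close>

lemma qintegral_variation_eq:
  assumes q: "q > 1" and a: "a \<noteq> 0"
    and at_a: "\<And>k. k < r \<Longrightarrow> \<eta> (q ^ k * a) = 0"
    and at_b: "\<And>k. k < r \<Longrightarrow> \<eta> (q ^ k * (a * q ^ n)) = 0"
  shows "qintegral q a (a * q ^ n)
      (\<lambda>t. \<Sum>i\<le>r. f i t * (qdiff q ^^ i) (\<eta> \<circ> (qsigma q ^^ (r - i))) t) =
    qintegral q a (a * q ^ n)
      (\<lambda>t. (\<Sum>i\<le>r. (-1) ^ i * (1 / q) ^ (i * (i - 1) div 2) * (qdiff q ^^ i) (f i) t)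
        * \<eta> (q ^ r * t))"
proof -
  have "qintegral q a (a * q ^ n)
        (\<lambda>t. f i t * (qdiff q ^^ i) (\<eta> \<circ> (qsigma q ^^ (r - i))) t) =
      (-1) ^ i * (1 / q) ^ (i * (i - 1) div 2) *
        qintegral q a (a * q ^ n) (\<lambda>t. (qdiff q ^^ i) (f i) t * \<eta> (q ^ r * t))"
    if "i \<le> r" for i
    using qintegral_by_parts_iterated[OF q a, of "r - i" i \<eta> n "f i"] at_a at_b that
    by (simp add: comp_def qsigma_funpow)
  then show ?thesis
    by (simp add: qintegral_sum sum_distrib_right mult.assoc qintegral_cmult[symmetric])
qed

lemma qatLeast_eq:
  assumes "q > 1" "a \<in> qset q"
  shows "qatLeast q a = range (\<lambda>n. a * q ^ n)"
proof -
  obtain p where p: "a = q ^ p" using assms(2) by (auto simp: qset_def)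
  have "q ^ s \<in> range (\<lambda>n. a * q ^ n)" if "a \<le> q ^ s" for s
  proof -
    have "p \<le> s" using that assms(1) p by simp
    then have "q ^ s = a * q ^ (s - p)" by (simp add: p flip: power_add)
    then show ?thesis by blast
  qed
  moreover have "a * q ^ n \<in> qset q" "a \<le> a * q ^ n" for n
    using assms(1) p by (auto simp: qset_def simp flip: power_add)
  ultimately show ?thesis by (auto simp: qatLeast_def qset_def)
qed

lemma qat_top_neq_bot:
  assumes "q > 1"
  shows "qat_top q a \<noteq> bot"
proof -
  have "\<exists>T\<ge>N. T \<in> qset q \<and> a < T" for N
  proof -
    obtain n where "max N a < q ^ n" using real_arch_pow[OF assms] by blast
    then show ?thesis by (intro exI[of _ "q ^ n"]) (auto simp: qset_def)
  qed
  then show ?thesis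
    by (auto simp: trivial_limit_def qat_top_def eventually_inf_principal eventually_at_top_linorder)
qed

text \<open>
  The infima over the tails \<open>T' \<ge> T\<close> are taken over nonempty sets, so an eventually constant
  function has that constant as its lower limit.
\<close>

lemma tendsto_INF_tail_const:
  fixes F :: "real \<Rightarrow> ereal"
  assumes "\<And>T. T \<in> qset q \<Longrightarrow> T \<ge> B \<Longrightarrow> F T = c"
  shows "((\<lambda>T. INF T' \<in> qatLeast q T. F T') \<longlongrightarrow> c) (qat_top q a)"
proof (rule tendsto_eventually)
  have "(INF T' \<in> qatLeast q T. F T') = c" if "T \<in> qset q" "T \<ge> B" for T
  proof -
    have "F T' = c" if "T' \<in> qatLeast q T" for T'
      using that \<open>T \<ge> B\<close> assms[of T'] by (simp add: qatLeast_def)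
    moreover have "qatLeast q T \<noteq> {}" using \<open>T \<in> qset q\<close> by (auto simp: qatLeast_def)
    ultimately show ?thesis by simp
  qed
  then show "\<forall>\<^sub>F T in qat_top q a. (INF T' \<in> qatLeast q T. F T') = c"
    unfolding qat_top_def eventually_inf_principal eventually_at_top_linorder by blast
qed

theorem lemma7:
  fixes q a :: real and r :: nat and f :: "nat \<Rightarrow> real \<Rightarrow> real"
  assumes "q > 1"
    and "a \<in> qset q"
    and "r \<ge> 1"
    and "\<And>\<eta> :: real \<Rightarrow> real.
      (\<And>j. j < r \<Longrightarrow> (qdiff q ^^ j) \<eta> a = 0) \<Longrightarrow>
      ((\<lambda>T. INF T' \<in> qatLeast q T.
          ereal (qintegral q a T'
            (\<lambda>t. \<Sum>i\<le>r. f i t * (qdiff q ^^ i) (\<eta> \<circ> (qsigma q ^^ (r - i))) t)))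
        \<longlongrightarrow> 0) (qat_top q a)"
  shows "\<forall>t \<in> qatLeast q a.
    (\<Sum>i\<le>r. (-1) ^ i * (1 / q) ^ (i * (i - 1) div 2) * (qdiff q ^^ i) (f i) t) = 0"
proof
  fix t assume "t \<in> qatLeast q a"
  then obtain m where t: "t = a * q ^ m"
    using qatLeast_eq[OF assms(1,2)] by auto
  have q: "q > 1" by fact
  have a: "a > 0" using assms(2) q by (auto simp: qset_def)
  define E where "E = (\<lambda>t. \<Sum>i\<le>r. (-1) ^ i * (1 / q) ^ (i * (i - 1) div 2) *
    (qdiff q ^^ i) (f i) t)"
  \<comment> \<open>The extra \<open>r\<close> in the exponent makes \<open>\<eta>\<close> vanish at the first \<open>r\<close> lattice points, and it
    cancels against \<open>\<sigma>\<^sup>r\<close>, so that \<open>\<eta> \<circ> \<sigma>\<^sup>r\<close> picks out the point \<open>t\<close>.\<close>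
  define \<eta> :: "real \<Rightarrow> real" where "\<eta> = (\<lambda>s. if s = q ^ (m + r) * a then 1 else 0)"
  have \<eta>_lattice: "\<eta> (q ^ k * a) = (if k = m + r then 1 else 0)" for k
    using q a by (simp add: \<eta>_def)
  let ?F = "\<lambda>T'. qintegral q a T'
    (\<lambda>t. \<Sum>i\<le>r. f i t * (qdiff q ^^ i) (\<eta> \<circ> (qsigma q ^^ (r - i))) t)"
  have value_F: "?F T' = a * (q - 1) * (q ^ m * E t)"
    if T': "T' \<in> qset q" "T' \<ge> a * q ^ (m + r + 1)" for T'
  proof -
    have "a \<le> a * q ^ (m + r + 1)"
      using q a one_le_power[of q "m + r + 1"] by simp
    then have "T' \<in> qatLeast q a" using T' by (simp add: qatLeast_def)
    then obtain n where n: "T' = a * q ^ n"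
      using qatLeast_eq[OF assms(1,2)] by auto
    have "q ^ (m + r + 1) \<le> q ^ n" using T'(2) a n by simp
    then have "m + r + 1 \<le> n" using q by (simp only: power_increasing_iff)
    then have large: "m + r < n" by simp
    have "?F T' = qintegral q a (a * q ^ n) (\<lambda>t. E t * \<eta> (q ^ r * t))"
      unfolding n E_def
    proof (rule qintegral_variation_eq)
      show "\<eta> (q ^ k * a) = 0" if "k < r" for k
        using that by (simp add: \<eta>_lattice)
      show "\<eta> (q ^ k * (a * q ^ n)) = 0" if "k < r" for k
        using \<eta>_lattice[of "k + n"] large by (simp add: power_add ac_simps)
    qed (use q a in auto)
    also have "\<dots> = a * (q - 1) * (\<Sum>k<n. q ^ k * (E (a * q ^ k) * \<eta> (q ^ r * (a * q ^ k))))"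
      using q a by (simp add: qintegral_eq_sum)
    also have "(\<Sum>k<n. q ^ k * (E (a * q ^ k) * \<eta> (q ^ r * (a * q ^ k)))) =
        (\<Sum>k<n. if k = m then q ^ m * E t else 0)"
    proof (rule sum.cong)
      fix k
      show "q ^ k * (E (a * q ^ k) * \<eta> (q ^ r * (a * q ^ k))) = (if k = m then q ^ m * E t else 0)"
        using \<eta>_lattice[of "k + r"] by (auto simp: power_add ac_simps t)
    qed simp
    also have "\<dots> = q ^ m * E t" using large by simp
    finally show ?thesis .
  qed
  have "((\<lambda>T. INF T' \<in> qatLeast q T. ereal (?F T')) \<longlongrightarrow> 0) (qat_top q a)"
  proof (rule assms(4))
    fix j assume "j < r"
    then show "(qdiff q ^^ j) \<eta> a = 0"
      by (intro qdiff_funpow_eq_0) (simp add: \<eta>_lattice)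
  qed
  moreover have "((\<lambda>T. INF T' \<in> qatLeast q T. ereal (?F T')) \<longlongrightarrow>
      ereal (a * (q - 1) * (q ^ m * E t))) (qat_top q a)"
    using value_F by (intro tendsto_INF_tail_const) simp
  ultimately have "0 = ereal (a * (q - 1) * (q ^ m * E t))"
    using tendsto_unique qat_top_neq_bot[OF q] by blast
  then show "(\<Sum>i\<le>r. (-1) ^ i * (1 / q) ^ (i * (i - 1) div 2) * (qdiff q ^^ i) (f i) t) = 0"
    using q a by (simp add: E_def flip: zero_ereal_def)
qed

end
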